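(* Let $f=\phi\circ T_0$ on (a neighborhood of) $\mathrm{St}(k,n)$, where $$T_0(P)=\begin{bmatrix} f_1(P)\\ \vdots\\ f_N(P)\end{bmatrix}\in\mathfrak{D}\subseteq\mathbb{R}^N,$$ and $\phi:\mathfrak{D}\to\mathbb{R}$ is convex and differentiable with partial derivatives $\phi_i(x)=\partial\phi(x)/\partial x_i$. Let $H_i(P)\in\mathbb{R}^{n\times n}$ ($1\le i\le N$, $P\in\mathrm{St}(k,n)$) be symmetric matrix-valued functions, and let $$H(P)=\sum_{i=1}^N\phi_i(T_0(P))\,H_i(P).$$ Suppose there are a subset $\mathbb{P}\subseteq\mathrm{St}(k,n)$ and constants $\underline{\alpha}>0$, $\underline{\beta}_i\ge0$, $\underline{\gamma}_i=\underline{\alpha}+\underline{\beta}_i$ such that, for $1\le i\le N$, (A) $\mathrm{tr}(P^{\mathrm T}H_i(P)P)=\underline{\gamma}_i f_i(P)$ for all $P\in\mathbb{P}$; (B) given $\widehat P\in\mathrm{St}(k,n)$ and $P\in\mathbb{P}$, there exists $Q\in\mathrm{St}(k,k)$ (the same $Q$ for all $i$) such that $\widetilde P=\widehat PQ\in\mathbb{P}$ and $$\mathrm{tr}(\widehat P^{\mathrm T}H_i(P)\widehat P)\le\underline{\alpha}f_i(\widetilde P)+\underline{\beta}_if_i(P).$$ If $\phi_i(x)\ge0$ (for all $x\in\mathfrak{D}$) for those $i$ for which the inequality in (B) does not become an equality, then the NEPv Ansatz holds for $f=\phi\circ T_0$ with $H$ (and $\mathbb{P}$), with $\omega=1/\u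nderline{\alpha}$.
   Context: $1\le k\le n$; $\mathrm{St}(k,n)=\{P\in\mathbb{R}^{n\times k}: P^{\mathrm T}P=I_k\}$; $\mathfrak{D}$ is a convex domain in $\mathbb{R}^N$. "The inequality in (B) becomes an equality for $i$" means that it holds with equality for index $i$ for all $P\in\mathbb{P}$, $\widehat P\in\mathrm{St}(k,n)$ and the corresponding $Q$ (as happens e.g. for $f_i(P)=\mathrm{tr}(P^{\mathrm T}A_iP)$ with $H_i(P)=2A_i$). NEPv Ansatz with constant $\omega>0$ (for $f$ with $H$ and $\mathbb{P}$): whenever $P\in\mathbb{P}$, $\widehat P\in\mathrm{St}(k,n)$ and $\eta\in\mathbb{R}$ satisfy $\mathrm{tr}(\widehat P^{\mathrm T}H(P)\widehat P)\ge\mathrm{tr}(P^{\mathrm T}H(P)P)+\eta$, there exists $Q\in\mathrm{St}(k,k)$ such that $\widetilde P=\widehat PQ\in\mathbb{P}$ and $f(\widetilde P)\ge f(P)+\omega\eta$. *)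

theory Defs
  imports "HOL-Analysis.Analysis"
begin

text \<open>An \<open>n \<times> k\<close> matrix has type \<open>real^'k^'n\<close> (rows indexed by \<open>'n\<close>). The set
  \<open>St(k,k)\<close> is the instance \<open>'n = 'k\<close>.\<close>

definition stiefel :: "(real^'k^'n) set" where
  "stiefel = {P. transpose P ** P = mat 1}"

text \<open>The two-sided partial derivative. It involves \<open>\<phi>\<close> in a neighbourhood of \<open>x\<close>, so it is
  meaningful only at points where \<open>\<phi>\<close> is differentiable in the full sense (for an open domain,
  at every point of it).\<close>

definition partial_deriv :: "'N \<Rightarrow> (real^'N \<Rightarrow> real) \<Rightarrow> real^'N \<Rightarrow> real" where
  "partial_deriv i \<phi> x = deriv (\<lambda>t. \<phi> (x + t *\<^sub>R axis i 1)) 0"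

definition T0 :: "('N \<Rightarrow> real^'k^'n \<Rightarrow> real) \<Rightarrow> real^'k^'n \<Rightarrow> real^'N" where
  "T0 f P = (\<chi> i. f i P)"

definition H_total ::
  "(real^'N \<Rightarrow> real) \<Rightarrow> ('N \<Rightarrow> real^'k^'n \<Rightarrow> real) \<Rightarrow> ('N \<Rightarrow> real^'k^'n \<Rightarrow> real^'n^'n)
    \<Rightarrow> real^'k^'n \<Rightarrow> real^'n^'n" where
  "H_total \<phi> f H P = (\<Sum>i\<in>UNIV. partial_deriv i \<phi> (T0 f P) *\<^sub>R H i P)"

definition NEPv_ansatz ::
  "(real^'k^'n \<Rightarrow> real) \<Rightarrow> (real^'k^'n \<Rightarrow> real^'n^'n) \<Rightarrow> (real^'k^'n) set \<Rightarrow> real \<Rightarrow> bool" where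
  "NEPv_ansatz f H \<PP> \<omega> \<longleftrightarrow> \<omega> > 0 \<and>
    (\<forall>P\<in>\<PP>. \<forall>P'\<in>stiefel. \<forall>\<eta>.
      trace (transpose P' ** H P ** P') \<ge> trace (transpose P ** H P ** P) + \<eta> \<longrightarrow>
      (\<exists>Q\<in>(stiefel :: (real^'k^'k) set). P' ** Q \<in> \<PP> \<and> f (P' ** Q) \<ge> f P + \<omega> * \<eta>))"

text \<open>In the two predicates below, \<open>Q P' P\<close> is the matrix \<open>Q\<close> that condition (B) assigns to
  \<open>P' \<in> St(k,n)\<close> and \<open>P \<in> \<PP>\<close>. It is named by a selection function, and not hidden under an
  existential quantifier, because the clause ``(B) becomes an equality for \<open>i\<close>'' refers to the
  same \<open>Q\<close>; in particular \<open>Q\<close> does not depend on \<open>i\<close>.\<close>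

definition condition_B ::
  "(real^'k^'n) set \<Rightarrow> ('N \<Rightarrow> real^'k^'n \<Rightarrow> real) \<Rightarrow> ('N \<Rightarrow> real^'k^'n \<Rightarrow> real^'n^'n)
    \<Rightarrow> real \<Rightarrow> ('N \<Rightarrow> real) \<Rightarrow> (real^'k^'n \<Rightarrow> real^'k^'n \<Rightarrow> real^'k^'k) \<Rightarrow> bool" where
  "condition_B \<PP> f H \<alpha> \<beta> Q \<longleftrightarrow>
    (\<forall>P'\<in>stiefel. \<forall>P\<in>\<PP>. Q P' P \<in> stiefel \<and> P' ** Q P' P \<in> \<PP> \<and>
      (\<forall>i. trace (transpose P' ** H i P ** P') \<le> \<alpha> * f i (P' ** Q P' P) + \<beta> i * f i P))"

definition equality_in_B ::
  "(real^'k^'n) set \<Rightarrow> ('N \<Rightarrow> real^'k^'n \<Rightarrow> real) \<Rightarrow> ('N \<Rightarrow> real^'k^'n \<Rightarrow> real^'n^'n)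
    \<Rightarrow> real \<Rightarrow> ('N \<Rightarrow> real) \<Rightarrow> (real^'k^'n \<Rightarrow> real^'k^'n \<Rightarrow> real^'k^'k) \<Rightarrow> 'N \<Rightarrow> bool" where
  "equality_in_B \<PP> f H \<alpha> \<beta> Q i \<longleftrightarrow>
    (\<forall>P'\<in>stiefel. \<forall>P\<in>\<PP>.
      trace (transpose P' ** H i P ** P') = \<alpha> * f i (P' ** Q P' P) + \<beta> i * f i P)"

end

theory Submission
  imports Defs
begin

text \<open>Weighting (B) by the partial derivatives of \<open>\<phi>\<close> at \<open>T\<^sub>0(P)\<close> and subtracting (A), the
  \<open>\<beta>\<^sub>i\<close>-terms cancel, so \<open>\<eta>\<close> is at most \<open>\<alpha>\<close> times the first-order change of \<open>\<phi>\<close> from \<open>T\<^sub>0(P)\<close>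
  to \<open>T\<^sub>0(P'Q)\<close>. A convex function lies above its tangent plane.\<close>

text \<open>Chain rule with an affine inner function. It serves two choices of \<open>v\<close>: a
  coordinate vector, giving a partial derivative, and \<open>y - x\<close>, giving the slope of a
  convex function along a segment.\<close>

lemma has_field_derivative_along_line:
  fixes \<phi> :: "'a::real_normed_vector \<Rightarrow> real"
  assumes "(\<phi> has_derivative L) (at x)"
  shows "((\<lambda>t. \<phi> (x + t *\<^sub>R v)) has_field_derivative L v) (at 0)"
proof -
  interpret L: bounded_linear L
    using assms by (rule has_derivative_bounded_linear)
  have "((\<lambda>t. x + t *\<^sub>R v) has_derivative (\<lambda>t. t *\<^sub>R v)) (at (0::real))"
    by (auto intro!: derivative_eq_intros)
  from has_derivative_compose[OF this, of \<phi> L]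
  have "((\<lambda>t. \<phi> (x + t *\<^sub>R v)) has_derivative (\<lambda>t. L (t *\<^sub>R v))) (at 0)"
    using assms by simp
  moreover have "(\<lambda>t. L (t *\<^sub>R v)) = (*) (L v)"
    by (simp add: fun_eq_iff L.scaleR)
  ultimately show ?thesis
    unfolding has_field_derivative_def by simp
qed

lemma partial_deriv_eq_derivative_axis:
  "(\<phi> has_derivative L) (at x) \<Longrightarrow> partial_deriv i \<phi> x = L (axis i 1)"
  unfolding partial_deriv_def by (rule DERIV_imp_deriv[OF has_field_derivative_along_line])

lemma linear_eq_sum_axis:
  fixes L :: "real^'n \<Rightarrow> real"
  assumes "linear L"
  shows "L v = (\<Sum>i\<in>UNIV. L (axis i 1) * v $ i)"
proof -
  have "L v = L (\<Sum>i\<in>UNIV. v $ i *\<^sub>R axis i 1)"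
    using basis_expansion[of v] by (simp add: scalar_mult_eq_scaleR)
  then show ?thesis
    by (simp add: linear_sum[OF assms] linear_scale[OF assms] mult.commute)
qed

text \<open>On the segment from \<open>x\<close> to \<open>y\<close>, convexity bounds each
  difference quotient with 0 < t < 1 by \<open>\<phi> y - \<phi> x\<close>; letting t tend to 0
  turns the quotient into \<open>L (y - x)\<close>.\<close>

lemma convex_on_above_tangent_plane:
  fixes \<phi> :: "'a::real_normed_vector \<Rightarrow> real"
  assumes cvx: "convex_on D \<phi>" and x: "x \<in> D" and y: "y \<in> D"
    and der: "(\<phi> has_derivative L) (at x)"
  shows "\<phi> x + L (y - x) \<le> \<phi> y"
proof -
  have "((\<lambda>t. (\<phi> (x + t *\<^sub>R (y - x)) - \<phi> x) / t) \<longlongrightarrow> L (y - x)) (at 0)"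
    using has_field_derivative_along_line[OF der, of "y - x"] by (simp add: DERIV_def)
  \<comment> \<open>Only the right-hand limit is of use: convexity bounds the quotient for positive
    t, where the point still lies between \<open>x\<close> and \<open>y\<close>.\<close>
  then have lim: "((\<lambda>t. (\<phi> (x + t *\<^sub>R (y - x)) - \<phi> x) / t) \<longlongrightarrow> L (y - x)) (at_right 0)"
    by (rule tendsto_mono[OF at_le, rotated]) simp
  have "(\<phi> (x + t *\<^sub>R (y - x)) - \<phi> x) / t \<le> \<phi> y - \<phi> x" if "0 < t" "t < 1" for t
  proof -
    have "\<phi> ((1 - t) *\<^sub>R x + t *\<^sub>R y) \<le> (1 - t) * \<phi> x + t * \<phi> y"
      using convex_onD[OF cvx, of t x y] that x y by simp
    moreover have "(1 - t) *\<^sub>R x + t *\<^sub>R y = x + t *\<^sub>R (y - x)"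
      by (simp add: algebra_simps)
    ultimately show ?thesis
      using that by (simp add: field_simps)
  qed
  then have "\<forall>\<^sub>F t in at_right 0. (\<phi> (x + t *\<^sub>R (y - x)) - \<phi> x) / t \<le> \<phi> y - \<phi> x"
    unfolding eventually_at_right_field by (intro exI[of _ 1]) auto
  with lim have "L (y - x) \<le> \<phi> y - \<phi> x"
    by (rule tendsto_upperbound) simp
  then show ?thesis by simp
qed

text \<open>The tangent-plane inequality in coordinates, so that the slope is expressed by the same
  partial derivatives that weight the matrices in \<open>H_total\<close>.\<close>

lemma convex_on_partial_deriv_le:
  fixes \<phi> :: "real^'n \<Rightarrow> real"
  assumes "convex_on D \<phi>" "x \<in> D" "y \<in> D" "\<phi> differentiable (at x)"
  shows "(\<Sum>i\<in>UNIV. partial_deriv i \<phi> x * (y $ i - x $ i)) \<le> \<phi> y - \<phi> x"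
proof -
  obtain L where L: "(\<phi> has_derivative L) (at x)"
    using assms(4) unfolding differentiable_def by blast
  have "L (y - x) = (\<Sum>i\<in>UNIV. partial_deriv i \<phi> x * (y $ i - x $ i))"
    using linear_eq_sum_axis[OF has_derivative_linear[OF L], of "y - x"]
    by (simp add: partial_deriv_eq_derivative_axis[OF L])
  then show ?thesis
    using convex_on_above_tangent_plane[OF assms(1-3) L] by simp
qed

text \<open>The trace is linear in the middle matrix. This splits the trace of
  \<open>H_total\<close> into those of the single \<open>H i\<close>, to which (A) and (B)
  apply.\<close>

lemma trace_congruence_sum:
  fixes P :: "real^'k^'n" and M :: "'i \<Rightarrow> real^'n^'n"
  shows "trace (transpose P ** (\<Sum>i\<in>I. c i *\<^sub>R M i) ** P)
    = (\<Sum>i\<in>I. c i * trace (transpose P ** M i ** P))"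
proof -
  have lin: "linear (\<lambda>A :: real^'n^'n. trace (transpose P ** A ** P))"
    by (rule linearI)
      (simp_all add: trace_def matrix_matrix_mult_def algebra_simps sum.distrib sum_distrib_left)
  show ?thesis
    by (simp add: linear_sum[OF lin] linear_scale[OF lin])
qed

theorem theorem8p1:
  fixes D :: "(real^'N) set"
    and \<phi> :: "real^'N \<Rightarrow> real"
    and f :: "'N \<Rightarrow> real^'k^'n \<Rightarrow> real"
    and H :: "'N \<Rightarrow> real^'k^'n \<Rightarrow> real^'n^'n"
    and \<PP> :: "(real^'k^'n) set"
    and \<alpha> :: real
    and \<beta> \<gamma> :: "'N \<Rightarrow> real"
    and Q :: "real^'k^'n \<Rightarrow> real^'k^'n \<Rightarrow> real^'k^'k"
  assumes "CARD('k) \<le> CARD('n)"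
    and "convex D"
    and "convex_on D \<phi>"
    and "\<forall>x\<in>D. \<phi> differentiable (at x)"
    and "\<forall>P\<in>stiefel. T0 f P \<in> D"
    and "\<forall>i. \<forall>P\<in>stiefel. transpose (H i P) = H i P"
    and "\<PP> \<subseteq> stiefel"
    and "\<alpha> > 0"
    and "\<forall>i. \<beta> i \<ge> 0"
    and "\<forall>i. \<gamma> i = \<alpha> + \<beta> i"
    and A: "\<forall>i. \<forall>P\<in>\<PP>. trace (transpose P ** H i P ** P) = \<gamma> i * f i P"
    and B: "condition_B \<PP> f H \<alpha> \<beta> Q"
    and "\<forall>i. \<not> equality_in_B \<PP> f H \<alpha> \<beta> Q i \<longrightarrow> (\<forall>x\<in>D. partial_deriv i \<phi> x \<ge> 0)"
  shows "NEPv_ansatz (\<phi> \<circ> T0 f) (H_total \<phi> f H) \<PP> (1 / \<alpha>)"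
  unfolding NEPv_ansatz_def
proof (intro conjI ballI allI impI)
  show "1 / \<alpha> > 0"
    using \<open>\<alpha> > 0\<close> by simp
next
  fix P P' :: "real^'k^'n" and \<eta> :: real
  assume P: "P \<in> \<PP>" and P': "P' \<in> stiefel"
    and \<eta>: "trace (transpose P ** H_total \<phi> f H P ** P) + \<eta>
      \<le> trace (transpose P' ** H_total \<phi> f H P ** P')"
  define R where "R = P' ** Q P' P"
  \<comment> \<open>The weights stay frozen at \<open>T0 f P\<close>, even in the trace formed with
    \<open>P'\<close>, because the Ansatz evaluates \<open>H_total\<close> at \<open>P\<close>
    only.\<close>
  define c where "c i = partial_deriv i \<phi> (T0 f P)" for i
  have Q: "Q P' P \<in> stiefel" and R: "R \<in> \<PP>"
    and le: "\<And>i. trace (transpose P' ** H i P ** P') \<le> \<alpha> * f i R + \<beta> i * f i P"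
    using B P P' unfolding condition_B_def R_def by blast+
  have D: "T0 f P \<in> D" "T0 f R \<in> D"
    using assms(5,7) P R by auto
  \<comment> \<open>An equality in (B) survives multiplication by a weight of any sign; a genuine
    inequality needs a nonnegative one.\<close>
  have "c i * trace (transpose P' ** H i P ** P') \<le> c i * (\<alpha> * f i R + \<beta> i * f i P)" for i
  proof (cases "equality_in_B \<PP> f H \<alpha> \<beta> Q i")
    case True
    then show ?thesis
      using P P' unfolding equality_in_B_def R_def by simp
  next
    case False
    then have "c i \<ge> 0"
      using assms(13) D unfolding c_def by blast
    with le show ?thesis
      by (rule mult_left_mono)
  qed
  then have upper: "trace (transpose P' ** H_total \<phi> f H P ** P')
      \<le> (\<Sum>i\<in>UNIV. c i * (\<alpha> * f i R + \<beta> i * f i P))"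
    unfolding H_total_def trace_congruence_sum c_def by (intro sum_mono)
  have "trace (transpose P ** H_total \<phi> f H P ** P) = (\<Sum>i\<in>UNIV. c i * (\<gamma> i * f i P))"
    using A P unfolding H_total_def trace_congruence_sum c_def by simp
  with \<eta> upper have "\<eta> \<le> (\<Sum>i\<in>UNIV. c i * (\<alpha> * f i R + \<beta> i * f i P))
      - (\<Sum>i\<in>UNIV. c i * (\<gamma> i * f i P))"
    by linarith
  \<comment> \<open>Since \<open>\<gamma> i = \<alpha> + \<beta> i\<close>, each summand reduces to
    \<open>c i * \<alpha> * (f i R - f i P)\<close>.\<close>
  also have "\<dots> = \<alpha> * (\<Sum>i\<in>UNIV. c i * (T0 f R $ i - T0 f P $ i))"
    using assms(10)
    by (simp add: T0_def sum_distrib_left sum_subtractf[symmetric] algebra_simps)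
  \<comment> \<open>Tangent plane of \<open>\<phi>\<close> at \<open>T0 f P\<close>, evaluated at
    \<open>T0 f R\<close>. Dividing by \<open>\<alpha>\<close> afterwards produces the constant
    \<open>1 / \<alpha>\<close>.\<close>
  also have "\<dots> \<le> \<alpha> * (\<phi> (T0 f R) - \<phi> (T0 f P))"
    using convex_on_partial_deriv_le[OF assms(3) D] assms(4) D \<open>\<alpha> > 0\<close>
    unfolding c_def by (intro mult_left_mono) auto
  finally have "\<phi> (T0 f P) + 1 / \<alpha> * \<eta> \<le> \<phi> (T0 f R)"
    using \<open>\<alpha> > 0\<close> by (simp add: field_simps)
  with Q R show "\<exists>Q\<in>stiefel. P' ** Q \<in> \<PP> \<and>
      (\<phi> \<circ> T0 f) P + 1 / \<alpha> * \<eta> \<le> (\<phi> \<circ> T0 f) (P' ** Q)"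
    unfolding R_def by auto
qed

end
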